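(* Any nondeterministic circuit of size $s$ and width $w$ can be converted to a deterministic circuit computing the same function, of size $2^{O((w + \log s)\log s)}$ and width $w + O(\log s)$.
   Context: Circuits are directed acyclic graphs whose in-degree-0 nodes (inputs) are labeled by a variable or a constant 0 or 1, and whose other nodes (gates) are AND gates of fan-in two, OR gates of fan-in two, or NOT gates; one node is the output. The size is the number of gates. For the width, every edge jumping over layers is subdivided by COPY gates (dummy gates outputting their input) so that the circuit is layered (every edge goes between adjacent layers); the width of a layer is its number of gates and the width of the circuit is the maximum layer width. A nondeterministic circuit has actual inputs $x_1,\dots,x_n$ and guess inputs $y_1,\dots,y_m$; it computes $f$ where $f(x)=1$ iff some setting of the guess inputs makes the circuit output 1. In a nondeterministic circuit each guess input labels at most one node, while actual inputs may label arbitrarily many nodes. A deterministic circuit has no guess inputs. *)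

theory Defs
  imports Complex_Main
begin

text \<open>
  A circuit is a finite DAG in which each gate names its in-neighbours. Parallel edges
  (both arguments of a gate coming from the same node) are allowed, so an edge is identified
  by its source, its target and the argument position at the target.
\<close>

datatype node_label =
    Const bool
  | Actual nat
  | Guess nat
  | And_Gate nat nat
  | Or_Gate nat nat
  | Not_Gate nat

fun preds :: "node_label \<Rightarrow> nat list" where
  "preds (And_Gate u v) = [u, v]"
| "preds (Or_Gate u v) = [u, v]"
| "preds (Not_Gate u) = [u]"
| "preds _ = []"

fun is_gate :: "node_label \<Rightarrow> bool" where
  "is_gate (And_Gate u v) = True"
| "is_gate (Or_Gate u v) = True"
| "is_gate (Not_Gate u) = True"
| "is_gate _ = False"

record circuit =
  nodes :: "nat set"
  label :: "nat \<Rightarrow> node_label"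
  out_node :: nat

definition edges :: "circuit \<Rightarrow> (nat \<times> nat \<times> nat) set" where
  "edges C = {(u, v, i). v \<in> nodes C \<and> i < length (preds (label C v)) \<and>
                         u = preds (label C v) ! i}"

definition adj :: "circuit \<Rightarrow> (nat \<times> nat) set" where
  "adj C = {(u, v). \<exists>i. (u, v, i) \<in> edges C}"

text \<open>\<open>n\<close> is the number of actual inputs and \<open>m\<close> the number of guess inputs.\<close>

definition is_circuit :: "nat \<Rightarrow> nat \<Rightarrow> circuit \<Rightarrow> bool" where
  "is_circuit n m C \<longleftrightarrow>
     finite (nodes C) \<and> out_node C \<in> nodes C \<and>
     (\<forall>v\<in>nodes C. set (preds (label C v)) \<subseteq> nodes C) \<and>
     acyclic (adj C) \<and>
     (\<forall>v\<in>nodes C. \<forall>i. label C v = Actual i \<longrightarrow> i < n) \<and>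
     (\<forall>v\<in>nodes C. \<forall>j. label C v = Guess j \<longrightarrow> j < m)"

definition nondeterministic_circuit :: "nat \<Rightarrow> nat \<Rightarrow> circuit \<Rightarrow> bool" where
  "nondeterministic_circuit n m C \<longleftrightarrow> is_circuit n m C \<and>
     (\<forall>u\<in>nodes C. \<forall>v\<in>nodes C. \<forall>j. label C u = Guess j \<and> label C v = Guess j \<longrightarrow> u = v)"

definition deterministic_circuit :: "nat \<Rightarrow> circuit \<Rightarrow> bool" where
  "deterministic_circuit n C \<longleftrightarrow> is_circuit n 0 C"

text \<open>\<open>node_value C x y v b\<close>: on actual inputs \<open>x\<close> and guess inputs \<open>y\<close>, node \<open>v\<close> carries \<open>b\<close>.\<close>

inductive node_value :: "circuit \<Rightarrow> bool list \<Rightarrow> bool list \<Rightarrow> nat \<Rightarrow> bool \<Rightarrow> bool"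
  for C x y where
  "label C v = Const b \<Longrightarrow> node_value C x y v b"
| "label C v = Actual i \<Longrightarrow> node_value C x y v (x ! i)"
| "label C v = Guess j \<Longrightarrow> node_value C x y v (y ! j)"
| "label C v = And_Gate u u' \<Longrightarrow> node_value C x y u a \<Longrightarrow> node_value C x y u' a' \<Longrightarrow>
     node_value C x y v (a \<and> a')"
| "label C v = Or_Gate u u' \<Longrightarrow> node_value C x y u a \<Longrightarrow> node_value C x y u' a' \<Longrightarrow>
     node_value C x y v (a \<or> a')"
| "label C v = Not_Gate u \<Longrightarrow> node_value C x y u a \<Longrightarrow> node_value C x y v (\<not> a)"

definition accepts :: "circuit \<Rightarrow> bool list \<Rightarrow> bool list \<Rightarrow> bool" where
  "accepts C x y \<longleftrightarrow> node_value C x y (out_node C) True"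

definition nondet_computes :: "nat \<Rightarrow> nat \<Rightarrow> circuit \<Rightarrow> (bool list \<Rightarrow> bool) \<Rightarrow> bool" where
  "nondet_computes n m C f \<longleftrightarrow>
     (\<forall>x. length x = n \<longrightarrow> (f x \<longleftrightarrow> (\<exists>y. length y = m \<and> accepts C x y)))"

definition det_computes :: "nat \<Rightarrow> circuit \<Rightarrow> (bool list \<Rightarrow> bool) \<Rightarrow> bool" where
  "det_computes n C f \<longleftrightarrow> (\<forall>x. length x = n \<longrightarrow> (f x \<longleftrightarrow> accepts C x []))"

definition gates :: "circuit \<Rightarrow> nat set" where
  "gates C = {v \<in> nodes C. is_gate (label C v)}"

definition circuit_size :: "circuit \<Rightarrow> nat" where
  "circuit_size C = card (gates C)"

text \<open>
  A layering places every node, input nodes included, on a layer so that edges go strictly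
  upwards; in particular an input may sit just below the gates that read it. An edge that
  jumps over layer \<open>k\<close> is subdivided by one COPY gate on layer \<open>k\<close>, and distinct edges are
  subdivided separately, so the COPY gates on layer \<open>k\<close> correspond to the edges jumping over \<open>k\<close>.
\<close>

definition layering :: "circuit \<Rightarrow> (nat \<Rightarrow> nat) \<Rightarrow> bool" where
  "layering C l \<longleftrightarrow> (\<forall>(u, v)\<in>adj C. l u < l v)"

definition copy_gates :: "circuit \<Rightarrow> (nat \<Rightarrow> nat) \<Rightarrow> nat \<Rightarrow> (nat \<times> nat \<times> nat) set" where
  "copy_gates C l k = {(u, v, i) \<in> edges C. l u < k \<and> k < l v}"

definition layer_width :: "circuit \<Rightarrow> (nat \<Rightarrow> nat) \<Rightarrow> nat \<Rightarrow> nat" where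
  "layer_width C l k = card {v \<in> gates C. l v = k} + card (copy_gates C l k)"

text \<open>The maximum layer width, for the best choice of the layering.\<close>

definition circuit_width :: "circuit \<Rightarrow> nat" where
  "circuit_width C = (LEAST w. \<exists>l. layering C l \<and> (\<forall>k. layer_width C l k \<le> w))"

lemma node_value_iff:
  "label C v = Const c \<Longrightarrow> node_value C x y v b \<longleftrightarrow> b = c"
  "label C v = Actual i \<Longrightarrow> node_value C x y v b \<longleftrightarrow> b = x ! i"
  "label C v = Guess j \<Longrightarrow> node_value C x y v b \<longleftrightarrow> b = y ! j"
  "label C v = And_Gate u u' \<Longrightarrow> node_value C x y v b \<longleftrightarrow>
     (\<exists>a a'. b = (a \<and> a') \<and> node_value C x y u a \<and> node_value C x y u' a')"
  "label C v = Or_Gate u u' \<Longrightarrow> node_value C x y v b \<longleftrightarrow>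
     (\<exists>a a'. b = (a \<or> a') \<and> node_value C x y u a \<and> node_value C x y u' a')"
  "label C v = Not_Gate u \<Longrightarrow> node_value C x y v b \<longleftrightarrow> (\<exists>a. b = (\<not> a) \<and> node_value C x y u a)"
  by (subst node_value.simps, simp, (rule eq_commute | rule refl)?)+

lemma node_value_unique:
  "node_value C x y v a \<Longrightarrow> node_value C x y v b \<Longrightarrow> a = b"
proof (induction arbitrary: b rule: node_value.induct)
  case (4 v u u' a a')
  then show ?case by (metis node_value_iff(4))
next
  case (5 v u u' a a')
  then show ?case by (metis node_value_iff(5))
next
  case (6 v u a)
  then show ?case by (metis node_value_iff(6))
qed (simp_all add: node_value_iff(1-3))

lemma finite_edges:
  assumes "finite (nodes C)"
  shows "finite (edges C)"
proof (rule finite_subset)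
  show "edges C \<subseteq> (\<Union>v\<in>nodes C. (\<lambda>i. (preds (label C v) ! i, v, i)) ` {..<length (preds (label C v))})"
    by (auto simp: edges_def)
qed (use assms in auto)

lemma wf_adj:
  assumes "is_circuit n m C"
  shows "wf (adj C)"
proof (rule finite_acyclic_wf)
  have "adj C \<subseteq> (\<lambda>(u, v, i). (u, v)) ` edges C"
    unfolding adj_def by (auto intro!: rev_image_eqI)
  then show "finite (adj C)"
    using assms finite_edges by (metis is_circuit_def finite_imageI finite_subset)
qed (use assms in \<open>simp add: is_circuit_def\<close>)

lemma preds_adj:
  assumes "v \<in> nodes C" "u \<in> set (preds (label C v))"
  shows "(u, v) \<in> adj C"
  using assms by (auto simp: adj_def edges_def in_set_conv_nth)

lemma node_value_total:
  assumes C: "is_circuit n m C" and "v \<in> nodes C"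
  shows "\<exists>b. node_value C x y v b"
  using wf_adj[OF C] \<open>v \<in> nodes C\<close>
proof (induction v rule: wf_induct_rule)
  case (less v)
  have *: "\<exists>b. node_value C x y u b" if "u \<in> set (preds (label C v))" for u
    using that less C by (meson is_circuit_def preds_adj subsetD)
  show ?case
  proof (cases "label C v")
    case (And_Gate u u')
    with * obtain a a' where "node_value C x y u a" "node_value C x y u' a'" by fastforce
    with And_Gate show ?thesis by (blast intro: node_value.intros)
  next
    case (Or_Gate u u')
    with * obtain a a' where "node_value C x y u a" "node_value C x y u' a'" by fastforce
    with Or_Gate show ?thesis by (blast intro: node_value.intros)
  next
    case (Not_Gate u)
    with * obtain a where "node_value C x y u a" by fastforce
    with Not_Gate show ?thesis by (blast intro: node_value.intros)
  qed (blast intro: node_value.intros)+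
qed

lemma ex_layering:
  assumes C: "is_circuit n m C"
  shows "\<exists>l. layering C l"
proof -
  let ?l = "\<lambda>v. card {u. (u, v) \<in> (adj C)\<^sup>+}"
  have "adj C \<subseteq> (\<lambda>(u, v, i). (u, v)) ` edges C"
    unfolding adj_def by (auto intro!: rev_image_eqI)
  then have fin: "finite (adj C)"
    using assms finite_edges by (metis is_circuit_def finite_imageI finite_subset)
  have "?l u < ?l v" if uv: "(u, v) \<in> adj C" for u v
  proof (rule psubset_card_mono)
    have "{u. (u, v) \<in> (adj C)\<^sup>+} \<subseteq> fst ` (adj C)\<^sup>+" by force
    then show "finite {u. (u, v) \<in> (adj C)\<^sup>+}"
      using fin by (meson finite_imageI finite_subset finite_trancl)
    have "(u, u) \<notin> (adj C)\<^sup>+"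
      using C by (auto simp: is_circuit_def acyclic_def)
    moreover have "(w, v) \<in> (adj C)\<^sup>+" if "(w, u) \<in> (adj C)\<^sup>+" for w
      using that uv by (rule trancl_into_trancl)
    moreover have "(u, v) \<in> (adj C)\<^sup>+"
      using uv by (rule r_into_trancl)
    ultimately show "{w. (w, u) \<in> (adj C)\<^sup>+} \<subset> {w. (w, v) \<in> (adj C)\<^sup>+}"
      by blast
  qed
  then show ?thesis
    unfolding layering_def by (intro exI[of _ ?l]) auto
qed

lemma circuit_width_attained:
  assumes C: "is_circuit n m C"
  shows "\<exists>l. layering C l \<and> (\<forall>k. layer_width C l k \<le> circuit_width C)"
proof -
  obtain l where l: "layering C l"
    using ex_layering[OF C] by blast
  have fin: "finite (gates C)" "finite (edges C)"
    using C finite_edges by (auto simp: is_circuit_def gates_def)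
  have "layer_width C l k \<le> card (gates C) + card (edges C)" for k
    unfolding layer_width_def copy_gates_def
    by (intro add_mono card_mono) (use fin in auto)
  with l have "\<exists>w l. layering C l \<and> (\<forall>k. layer_width C l k \<le> w)"
    by blast
  then show ?thesis
    unfolding circuit_width_def by (rule LeastI_ex)
qed

end

theory Submission
  imports Defs
begin

text \<open>
  Regard every node of the circuit as a Boolean variable and every gate as a constraint on itself
  and its two arguments. If the gates are sorted by layer, then any cut of this sequence is
  straddled by at most \<open>3 w\<close> variables, so that satisfiability of the constraints in an interval
  can be expressed, as in Savitch's theorem, by a disjunction over the values of the variables
  straddling its midpoint, of the conjunction of the two halves. This yields a formula of size
  \<open>2^O(w log s)\<close>. Evaluating it sequentially (in postorder, one gate per layer), only
  the accumulators of the pending disjunctions and conjunctions have to be carried along, two for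
  each of the \<open>O(log s)\<close> levels of the recursion.
\<close>

section \<open>Formulas and their sequential evaluation\<close>

datatype formula =
    FConst bool
  | FVar nat
  | FAnd formula formula
  | FOr formula formula
  | FNot formula

fun holds :: "bool list \<Rightarrow> formula \<Rightarrow> bool" where
  "holds x (FConst b) = b"
| "holds x (FVar i) = x ! i"
| "holds x (FAnd F G) = (holds x F \<and> holds x G)"
| "holds x (FOr F G) = (holds x F \<or> holds x G)"
| "holds x (FNot F) = (\<not> holds x F)"

fun fvars :: "formula \<Rightarrow> nat set" where
  "fvars (FConst b) = {}"
| "fvars (FVar i) = {i}"
| "fvars (FAnd F G) = fvars F \<union> fvars G"
| "fvars (FOr F G) = fvars F \<union> fvars G"
| "fvars (FNot F) = fvars F"

text \<open>Leaves count as well: every occurrence of a constant or variable gets a node of its own,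
  so the circuit built from a formula is a tree and \<open>node_count\<close> is the length of its
  block of positions.\<close>

fun node_count :: "formula \<Rightarrow> nat" where
  "node_count (FConst b) = 1"
| "node_count (FVar i) = 1"
| "node_count (FAnd F G) = node_count F + node_count G + 1"
| "node_count (FOr F G) = node_count F + node_count G + 1"
| "node_count (FNot F) = node_count F + 1"

fun gate_count :: "formula \<Rightarrow> nat" where
  "gate_count (FConst b) = 0"
| "gate_count (FVar i) = 0"
| "gate_count (FAnd F G) = gate_count F + gate_count G + 1"
| "gate_count (FOr F G) = gate_count F + gate_count G + 1"
| "gate_count (FNot F) = gate_count F + 1"

text \<open>The left argument is evaluated first, and its value is kept while the right one is evaluated.\<close>

fun fwidth :: "formula \<Rightarrow> nat" where
  "fwidth (FConst b) = 0"
| "fwidth (FVar i) = 0"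
| "fwidth (FAnd F G) = max (fwidth F) (fwidth G + 1)"
| "fwidth (FOr F G) = max (fwidth F) (fwidth G + 1)"
| "fwidth (FNot F) = max (fwidth F) 1"

text \<open>\<open>placed L p F\<close>: the labels at \<open>p, p + 1, \<dots>\<close> list the nodes of \<open>F\<close> in postorder.\<close>

fun placed :: "(nat \<Rightarrow> node_label) \<Rightarrow> nat \<Rightarrow> formula \<Rightarrow> bool" where
  "placed L p (FConst b) \<longleftrightarrow> L p = Const b"
| "placed L p (FVar i) \<longleftrightarrow> L p = Actual i"
| "placed L p (FAnd F G) \<longleftrightarrow> placed L p F \<and> placed L (p + node_count F) G \<and>
     L (p + node_count F + node_count G) =
       And_Gate (p + node_count F - 1) (p + node_count F + node_count G - 1)"
| "placed L p (FOr F G) \<longleftrightarrow> placed L p F \<and> placed L (p + node_count F) G \<and>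
     L (p + node_count F + node_count G) =
       Or_Gate (p + node_count F - 1) (p + node_count F + node_count G - 1)"
| "placed L p (FNot F) \<longleftrightarrow> placed L p F \<and>
     L (p + node_count F) = Not_Gate (p + node_count F - 1)"

section \<open>Postorder labellings: existence, order, values and number of gates\<close>

lemma node_count_pos: "0 < node_count F"
  by (induction F) auto

lemma placed_cong:
  "(\<And>k. p \<le> k \<Longrightarrow> k < p + node_count F \<Longrightarrow> L k = L' k) \<Longrightarrow> placed L p F \<longleftrightarrow> placed L' p F"
proof (induction F arbitrary: p)
  case (FAnd F G)
  have "placed L p F \<longleftrightarrow> placed L' p F" "placed L (p + node_count F) G \<longleftrightarrow> placed L' (p + node_count F) G"
    by (rule FAnd.IH; use FAnd.prems in simp)+
  then show ?case using FAnd.prems by simp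
next
  case (FOr F G)
  have "placed L p F \<longleftrightarrow> placed L' p F" "placed L (p + node_count F) G \<longleftrightarrow> placed L' (p + node_count F) G"
    by (rule FOr.IH; use FOr.prems in simp)+
  then show ?case using FOr.prems by simp
next
  case (FNot F)
  have "placed L p F \<longleftrightarrow> placed L' p F"
    by (rule FNot.IH; use FNot.prems in simp)
  then show ?case using FNot.prems by simp
qed auto

lemma ex_placed: "\<exists>L. placed L p F"
proof (induction F arbitrary: p)
  case (FConst b)
  show ?case by (rule exI[of _ "\<lambda>_. Const b"]) simp
next
  case (FVar i)
  show ?case by (rule exI[of _ "\<lambda>_. Actual i"]) simp
next
  case (FAnd F G)
  let ?q = "p + node_count F" and ?r = "p + node_count F + node_count G"
  obtain L L' where L: "placed L p F" "placed L' ?q G" using FAnd.IH by blast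
  let ?L = "\<lambda>k. if k < ?q then L k else if k < ?r then L' k else And_Gate (?q - 1) (?r - 1)"
  have "placed ?L p F" "placed ?L ?q G"
    using L by (simp_all cong: placed_cong)
  then show ?case by (intro exI[of _ ?L]) simp
next
  case (FOr F G)
  let ?q = "p + node_count F" and ?r = "p + node_count F + node_count G"
  obtain L L' where L: "placed L p F" "placed L' ?q G" using FOr.IH by blast
  let ?L = "\<lambda>k. if k < ?q then L k else if k < ?r then L' k else Or_Gate (?q - 1) (?r - 1)"
  have "placed ?L p F" "placed ?L ?q G"
    using L by (simp_all cong: placed_cong)
  then show ?case by (intro exI[of _ ?L]) simp
next
  case (FNot F)
  let ?q = "p + node_count F"
  obtain L where L: "placed L p F" using FNot.IH by blast
  let ?L = "\<lambda>k. if k < ?q then L k else Not_Gate (?q - 1)"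
  have "placed ?L p F"
    using L by (simp cong: placed_cong)
  then show ?case by (intro exI[of _ ?L]) simp
qed

lemma binary_range:
  "{p..<p + (a + b + 1)} = {p..<p + a} \<union> {p + a..<p + a + b} \<union> {p + a + b :: nat}"
  by auto

lemma unary_range: "{p..<p + (a + 1)} = {p..<p + a} \<union> {p + a :: nat}"
  by auto

lemma binary_range_cases:
  fixes p :: nat
  assumes "v \<in> {p..<p + (a + b + 1)}"
  obtains "v \<in> {p..<p + a}" | "v \<in> {p + a..<p + a + b}" | "v = p + a + b"
  using assms unfolding binary_range by blast

lemma unary_range_cases:
  fixes p :: nat
  assumes "v \<in> {p..<p + (a + 1)}"
  obtains "v \<in> {p..<p + a}" | "v = p + a"
  using assms unfolding unary_range by blast

text \<open>The upper bound makes the numbering a topological order, which yields acyclicity and the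
  layering by position. The lower bound says that a block refers only to itself, so an edge into a
  later block never jumps over a position of an earlier one.\<close>

lemma placed_preds:
  "placed L p F \<Longrightarrow> v \<in> {p..<p + node_count F} \<Longrightarrow> u \<in> set (preds (L v)) \<Longrightarrow> p \<le> u \<and> u < v"
proof (induction F arbitrary: p)
  case (FAnd F G)
  have pos: "0 < node_count F" "0 < node_count G" by (rule node_count_pos)+
  from FAnd.prems(2) show ?case unfolding node_count.simps
  proof (cases rule: binary_range_cases)
    case 1
    then show ?thesis using FAnd.IH(1)[of p] FAnd.prems by simp
  next
    case 2
    then show ?thesis using FAnd.IH(2)[of "p + node_count F"] FAnd.prems by auto
  next
    case 3
    then show ?thesis using FAnd.prems pos by auto
  qed
next
  case (FOr F G)
  have pos: "0 < node_count F" "0 < node_count G" by (rule node_count_pos)+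
  from FOr.prems(2) show ?case unfolding node_count.simps
  proof (cases rule: binary_range_cases)
    case 1
    then show ?thesis using FOr.IH(1)[of p] FOr.prems by simp
  next
    case 2
    then show ?thesis using FOr.IH(2)[of "p + node_count F"] FOr.prems by auto
  next
    case 3
    then show ?thesis using FOr.prems pos by auto
  qed
next
  case (FNot F)
  have pos: "0 < node_count F" by (rule node_count_pos)
  from FNot.prems(2) show ?case unfolding node_count.simps
  proof (cases rule: unary_range_cases)
    case 1
    then show ?thesis using FNot.IH[of p] FNot.prems by simp
  next
    case 2
    then show ?thesis using FNot.prems pos by auto
  qed
qed auto

lemma placed_inputs:
  "placed L p F \<Longrightarrow> v \<in> {p..<p + node_count F} \<Longrightarrow>
    L v \<noteq> Guess j \<and> (L v = Actual i \<longrightarrow> i \<in> fvars F)"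
proof (induction F arbitrary: p)
  case (FAnd F G)
  from FAnd.prems(2) show ?case unfolding node_count.simps
    by (cases rule: binary_range_cases) (use FAnd.prems(1) FAnd.IH in \<open>fastforce+\<close>)
next
  case (FOr F G)
  from FOr.prems(2) show ?case unfolding node_count.simps
    by (cases rule: binary_range_cases) (use FOr.prems(1) FOr.IH in \<open>fastforce+\<close>)
next
  case (FNot F)
  from FNot.prems(2) show ?case unfolding node_count.simps
    by (cases rule: unary_range_cases) (use FNot.prems(1) FNot.IH in \<open>fastforce+\<close>)
qed auto

text \<open>In postorder the root of a block comes last, at \<open>p + node_count F - 1\<close>;
  these are the positions that the parent gates name.\<close>

lemma placed_value:
  "placed (label C) p F \<Longrightarrow> node_value C x y (p + node_count F - 1) (holds x F)"
proof (induction F arbitrary: p)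
  case (FAnd F G)
  let ?q = "p + node_count F"
  have "node_value C x y (?q + node_count G) (holds x F \<and> holds x G)"
    using FAnd.IH(1)[of p] FAnd.IH(2)[of ?q] FAnd.prems by (intro node_value.intros(4)) auto
  then show ?case by (simp add: add.assoc)
next
  case (FOr F G)
  let ?q = "p + node_count F"
  have "node_value C x y (?q + node_count G) (holds x F \<or> holds x G)"
    using FOr.IH(1)[of p] FOr.IH(2)[of ?q] FOr.prems by (intro node_value.intros(5)) auto
  then show ?case by (simp add: add.assoc)
next
  case (FNot F)
  have "node_value C x y (p + node_count F) (\<not> holds x F)"
    using FNot.IH[of p] FNot.prems by (intro node_value.intros(6)) auto
  then show ?case by simp
qed (auto intro: node_value.intros)

lemma placed_gates:
  "placed L p F \<Longrightarrow> card {v \<in> {p..<p + node_count F}. is_gate (L v)} \<le> gate_count F"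
proof (induction F arbitrary: p)
  case (FAnd F G)
  let ?q = "p + node_count F"
  have "{v \<in> {p..<p + node_count (FAnd F G)}. is_gate (L v)} \<subseteq>
      {v \<in> {p..<?q}. is_gate (L v)} \<union> {v \<in> {?q..<?q + node_count G}. is_gate (L v)} \<union> {?q + node_count G}"
    by auto
  then have "card {v \<in> {p..<p + node_count (FAnd F G)}. is_gate (L v)} \<le>
      card ({v \<in> {p..<?q}. is_gate (L v)} \<union> {v \<in> {?q..<?q + node_count G}. is_gate (L v)} \<union> {?q + node_count G})"
    by (intro card_mono) auto
  also have "\<dots> \<le> card {v \<in> {p..<?q}. is_gate (L v)} + card {v \<in> {?q..<?q + node_count G}. is_gate (L v)} + 1"
    by (intro order.trans[OF card_Un_le] add_mono card_Un_le) auto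
  finally show ?case
    using FAnd.IH(1)[of p] FAnd.IH(2)[of ?q] FAnd.prems by simp
next
  case (FOr F G)
  let ?q = "p + node_count F"
  have "{v \<in> {p..<p + node_count (FOr F G)}. is_gate (L v)} \<subseteq>
      {v \<in> {p..<?q}. is_gate (L v)} \<union> {v \<in> {?q..<?q + node_count G}. is_gate (L v)} \<union> {?q + node_count G}"
    by auto
  then have "card {v \<in> {p..<p + node_count (FOr F G)}. is_gate (L v)} \<le>
      card ({v \<in> {p..<?q}. is_gate (L v)} \<union> {v \<in> {?q..<?q + node_count G}. is_gate (L v)} \<union> {?q + node_count G})"
    by (intro card_mono) auto
  also have "\<dots> \<le> card {v \<in> {p..<?q}. is_gate (L v)} + card {v \<in> {?q..<?q + node_count G}. is_gate (L v)} + 1"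
    by (intro order.trans[OF card_Un_le] add_mono card_Un_le) auto
  finally show ?case
    using FOr.IH(1)[of p] FOr.IH(2)[of ?q] FOr.prems by simp
next
  case (FNot F)
  let ?q = "p + node_count F"
  have "{v \<in> {p..<p + node_count (FNot F)}. is_gate (L v)} \<subseteq>
      {v \<in> {p..<?q}. is_gate (L v)} \<union> {?q}"
    by auto
  then have "card {v \<in> {p..<p + node_count (FNot F)}. is_gate (L v)} \<le>
      card ({v \<in> {p..<?q}. is_gate (L v)} \<union> {?q})"
    by (intro card_mono) auto
  also have "\<dots> \<le> card {v \<in> {p..<?q}. is_gate (L v)} + 1"
    by (intro order.trans[OF card_Un_le] add_mono) auto
  finally show ?case
    using FNot.IH[of p] FNot.prems by simp
qed auto

text \<open>For the layering by position these are the COPY gates on layer \<open>k\<close> of edges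
  with target in \<open>A\<close>. Restricting the target makes the set split along the blocks of a
  formula.\<close>

definition crossing :: "(nat \<Rightarrow> node_label) \<Rightarrow> nat set \<Rightarrow> nat \<Rightarrow> (nat \<times> nat \<times> nat) set" where
  "crossing L A k = {(u, v, i). v \<in> A \<and> i < length (preds (L v)) \<and> u = preds (L v) ! i \<and> u < k \<and> k < v}"

lemma crossing_Un: "crossing L (A \<union> B) k = crossing L A k \<union> crossing L B k"
  by (auto simp: crossing_def)

lemma crossing_below: "(\<And>v. v \<in> A \<Longrightarrow> v \<le> k) \<Longrightarrow> crossing L A k = {}"
  by (force simp: crossing_def)

lemma crossing_above:
  "(\<And>v u. v \<in> A \<Longrightarrow> u \<in> set (preds (L v)) \<Longrightarrow> k \<le> u) \<Longrightarrow> crossing L A k = {}"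
  unfolding crossing_def by (fastforce dest: nth_mem)

text \<open>Inside the block of \<open>F\<close> nothing else crosses, since all later edges start
  at or above \<open>k\<close>. Inside the block of \<open>G\<close> the edges into \<open>F\<close>
  have ended, and the only extra edge carries the value of \<open>F\<close> from
  \<open>q - 1\<close> to \<open>r\<close>; this costs the \<open>+ 1\<close>. At \<open>r\<close>
  only the gate itself remains.\<close>

lemma crossing_binary:
  assumes L: "placed L p F" "placed L q G" "q = p + node_count F" "r = q + node_count G"
    and r: "preds (L r) = [q - 1, r - 1]"
    and F: "\<And>k. k \<in> {p..<p + node_count F} \<Longrightarrow>
      card (crossing L {p..<p + node_count F} k) + of_bool (is_gate (L k)) \<le> a"
    and G: "\<And>k. k \<in> {q..<q + node_count G} \<Longrightarrow>
      card (crossing L {q..<q + node_count G} k) + of_bool (is_gate (L k)) \<le> b"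
    and k: "k \<in> {p..<p + (node_count F + node_count G + 1)}"
  shows "card (crossing L {p..<p + (node_count F + node_count G + 1)} k) + of_bool (is_gate (L k))
    \<le> max a (b + 1)"
proof -
  have pos: "0 < node_count F" "0 < node_count G" by (rule node_count_pos)+
  have split: "crossing L {p..<p + (node_count F + node_count G + 1)} k =
      crossing L {p..<p + node_count F} k \<union> crossing L {q..<q + node_count G} k \<union> crossing L {r} k"
    unfolding binary_range crossing_Un using L by simp
  consider "k \<in> {p..<p + node_count F}" | "k \<in> {q..<q + node_count G}" | "k = r"
    using k L by force
  then show ?thesis
  proof cases
    case 1
    have "k \<le> u" if "v \<in> {q..<q + node_count G}" "u \<in> set (preds (L v))" for v u
      using placed_preds[OF L(2) that] 1 L(3) by simp
    then have "crossing L {q..<q + node_count G} k = {}"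
      by (rule crossing_above)
    moreover have "crossing L {r} k = {}"
      by (rule crossing_above) (use r 1 L pos in auto)
    ultimately show ?thesis using F[OF 1] split by simp
  next
    case 2
    have 0: "crossing L {p..<p + node_count F} k = {}"
      by (rule crossing_below) (use 2 L in auto)
    \<comment> \<open>The right argument \<open>r - 1\<close> is not below \<open>k\<close>, so only
      the edge from the left argument can jump over \<open>k\<close>.\<close>
    have "crossing L {r} k \<subseteq> {(q - 1, r, 0)}"
      using 2 L pos r by (auto simp: crossing_def less_Suc_eq)
    then have "card (crossing L {r} k) \<le> 1"
      using card_mono[of "{(q - 1, r, 0::nat)}"] by fastforce
    with 0 split have "card (crossing L {p..<p + (node_count F + node_count G + 1)} k)
        \<le> card (crossing L {q..<q + node_count G} k) + 1"
      using card_Un_le[of "crossing L {q..<q + node_count G} k" "crossing L {r} k"] by simp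
    then show ?thesis using G[OF 2] by linarith
  next
    case 3
    have "crossing L {p..<p + (node_count F + node_count G + 1)} k = {}"
      by (rule crossing_below) (use 3 L in auto)
    then show ?thesis by (simp add: le_max_iff_disj)
  qed
qed

lemma placed_width:
  "placed L p F \<Longrightarrow> k \<in> {p..<p + node_count F} \<Longrightarrow>
    card (crossing L {p..<p + node_count F} k) + of_bool (is_gate (L k)) \<le> fwidth F"
proof (induction F arbitrary: p k)
  case (FAnd F G)
  from FAnd.prems have L: "placed L p F" "placed L (p + node_count F) G" by auto
  show ?case
    using crossing_binary[OF L refl refl _ FAnd.IH(1)[OF L(1)] FAnd.IH(2)[OF L(2)]] FAnd.prems by simp
next
  case (FOr F G)
  from FOr.prems have L: "placed L p F" "placed L (p + node_count F) G" by auto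
  show ?case
    using crossing_binary[OF L refl refl _ FOr.IH(1)[OF L(1)] FOr.IH(2)[OF L(2)]] FOr.prems by simp
next
  case (FNot F)
  let ?r = "p + node_count F"
  have pos: "0 < node_count F" by (rule node_count_pos)
  have split: "crossing L {p..<p + node_count (FNot F)} k = crossing L {p..<?r} k \<union> crossing L {?r} k"
    unfolding node_count.simps unary_range crossing_Un by simp
  have r: "crossing L {?r} k = {}" if "k \<in> {p..<?r}"
    by (rule crossing_above) (use FNot.prems that in auto)
  have r': "crossing L {?r} ?r = {}"
    by (rule crossing_below) simp
  show ?case
  proof (cases "k = ?r")
    case True
    have "crossing L {p..<?r} k = {}"
      by (rule crossing_below) (use True in auto)
    then show ?thesis using r' split True by simp
  next
    case False
    then have k: "k \<in> {p..<?r}" using FNot.prems by simp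
    then have "card (crossing L {p..<?r} k) + of_bool (is_gate (L k)) \<le> fwidth F"
      using FNot by simp
    then show ?thesis using r[OF k] split by simp
  qed
qed (use crossing_below[of "{k}" k for k] in auto)

lemma formula_circuit:
  assumes "fvars F \<subseteq> {..<n}"
  obtains D where "deterministic_circuit n D" "\<And>x. accepts D x [] \<longleftrightarrow> holds x F"
    "circuit_size D \<le> gate_count F" "circuit_width D \<le> fwidth F"
proof -
  obtain L where L: "placed L 0 F" using ex_placed by blast
  let ?N = "node_count F"
  define D where "D = \<lparr>nodes = {..<?N}, label = L, out_node = ?N - 1\<rparr>"
  have D: "nodes D = {0..<0 + ?N}" "label D = L" "out_node D = 0 + ?N - 1"
    by (auto simp: D_def)
  have adj: "u < v" if "(u, v) \<in> adj D" for u v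
    using that placed_preds[OF L, of v u] by (auto simp: adj_def edges_def D)
  have circ: "is_circuit n 0 D"
    unfolding is_circuit_def
  proof (intro conjI ballI allI impI)
    show "out_node D \<in> nodes D" using node_count_pos[of F] by (simp add: D)
    show "set (preds (label D v)) \<subseteq> nodes D" if "v \<in> nodes D" for v
      using placed_preds[OF L, of v] that by (fastforce simp: D)
    have "adj D \<subseteq> less_than" using adj by auto
    then show "acyclic (adj D)" by (meson acyclic_subset wf_acyclic wf_less_than)
  qed (use placed_inputs[OF L] assms in \<open>auto simp: D\<close>)
  have val: "node_value D x [] (out_node D) (holds x F)" for x
    unfolding D(3) by (rule placed_value) (simp add: D L)
  have width: "circuit_width D \<le> fwidth F"
    unfolding circuit_width_def
  proof (intro Least_le exI conjI allI)
    \<comment> \<open>One node per layer: the width at \<open>k\<close> is the gate at position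
      \<open>k\<close>, if there is one, plus the edges crossing \<open>k\<close>.\<close>
    show "layering D (\<lambda>v. v)" using adj by (auto simp: layering_def)
    fix k
    have copy: "copy_gates D (\<lambda>v. v) k = crossing L {0..<0 + ?N} k"
      by (auto simp: copy_gates_def crossing_def edges_def D)
    have gate: "{v \<in> gates D. v = k} = (if k \<in> {0..<0 + ?N} \<and> is_gate (L k) then {k} else {})"
      by (auto simp: gates_def D)
    show "layer_width D (\<lambda>v. v) k \<le> fwidth F"
    proof (cases "k \<in> {0..<0 + ?N}")
      case True
      then show ?thesis
        using placed_width[OF L True] unfolding layer_width_def copy gate by (simp add: of_bool_def split: if_splits)
    next
      case False
      then have "crossing L {0..<0 + ?N} k = {}"
        by (intro crossing_below) auto
      with False show ?thesis unfolding layer_width_def copy gate by simp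
    qed
  qed
  show thesis
  proof (rule that)
    show "deterministic_circuit n D" using circ by (simp add: deterministic_circuit_def)
    show "accepts D x [] \<longleftrightarrow> holds x F" for x
      using val[of x] node_value_unique unfolding accepts_def by metis
    show "circuit_size D \<le> gate_count F"
      using placed_gates[OF L] by (simp add: circuit_size_def gates_def D)
  qed (rule width)
qed

section \<open>Evaluation as constraint satisfaction\<close>

fun gate_ok :: "node_label \<Rightarrow> (nat \<Rightarrow> bool) \<Rightarrow> bool \<Rightarrow> bool" where
  "gate_ok (And_Gate u u') \<sigma> b \<longleftrightarrow> b = (\<sigma> u \<and> \<sigma> u')"
| "gate_ok (Or_Gate u u') \<sigma> b \<longleftrightarrow> b = (\<sigma> u \<or> \<sigma> u')"
| "gate_ok (Not_Gate u) \<sigma> b \<longleftrightarrow> b = (\<not> \<sigma> u)"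
| "gate_ok _ \<sigma> b \<longleftrightarrow> True"

fun input_ok :: "bool list \<Rightarrow> node_label \<Rightarrow> bool \<Rightarrow> bool" where
  "input_ok x (Const c) b \<longleftrightarrow> b = c"
| "input_ok x (Actual i) b \<longleftrightarrow> b = x ! i"
| "input_ok x _ b \<longleftrightarrow> True"

text \<open>Input nodes have no constraint of their own, as their number is not bounded by the size;
  instead each gate also checks the inputs among its arguments. Guess inputs stay free.\<close>

definition satisfied :: "circuit \<Rightarrow> bool list \<Rightarrow> (nat \<Rightarrow> bool) \<Rightarrow> nat \<Rightarrow> bool" where
  "satisfied C x \<sigma> v \<longleftrightarrow> gate_ok (label C v) \<sigma> (\<sigma> v) \<and>
     (\<forall>u\<in>set (preds (label C v)). input_ok x (label C u) (\<sigma> u))"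

definition vars :: "circuit \<Rightarrow> nat \<Rightarrow> nat list" where
  "vars C v = v # preds (label C v)"

lemma satisfied_cong:
  assumes "\<And>u. u \<in> set (vars C v) \<Longrightarrow> \<sigma> u = \<tau> u"
  shows "satisfied C x \<sigma> v \<longleftrightarrow> satisfied C x \<tau> v"
  using assms unfolding satisfied_def vars_def by (cases "label C v") auto

text \<open>Forwards, the node values form the assignment. Backwards, the guess string is read off
  \<sigma>, consistently because a guess labels at most one node, and induction along the edges
  shows that \<sigma> is the evaluation on all gates, in particular on the output.\<close>

lemma accepts_iff_satisfiable:
  assumes C: "nondeterministic_circuit n m C" and out: "out_node C \<in> gates C"
  shows "(\<exists>y. length y = m \<and> accepts C x y) \<longleftrightarrow>
    (\<exists>\<sigma>. \<sigma> (out_node C) \<and> (\<forall>v\<in>gates C. satisfied C x \<sigma> v))"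
proof
  have circ: "is_circuit n m C" using C by (simp add: nondeterministic_circuit_def)
  assume "\<exists>y. length y = m \<and> accepts C x y"
  then obtain y where y: "accepts C x y" by blast
  define \<sigma> where "\<sigma> v \<longleftrightarrow> node_value C x y v True" for v
  have val: "\<sigma> v \<longleftrightarrow> b" if "node_value C x y v b" for v b
    using that node_value_unique unfolding \<sigma>_def by metis
  have nv: "node_value C x y v (\<sigma> v)" if "v \<in> nodes C" for v
    using node_value_total[OF circ that, of x y] val by blast
  have "satisfied C x \<sigma> v" if v: "v \<in> gates C" for v
    unfolding satisfied_def
  proof
    have P: "u \<in> nodes C" if "u \<in> set (preds (label C v))" for u
      using circ v that unfolding is_circuit_def gates_def by blast
    then show "\<forall>u\<in>set (preds (label C v)). input_ok x (label C u) (\<sigma> u)"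
    proof (intro ballI)
      fix u
      show "input_ok x (label C u) (\<sigma> u)"
        by (cases "label C u") (auto intro!: val intro: node_value.intros)
    qed
    show "gate_ok (label C v) \<sigma> (\<sigma> v)"
    proof (cases "label C v")
      case (And_Gate u u')
      then have "node_value C x y v (\<sigma> u \<and> \<sigma> u')"
        by (rule node_value.intros) (use P nv And_Gate in auto)
      with And_Gate val show ?thesis by simp
    next
      case (Or_Gate u u')
      then have "node_value C x y v (\<sigma> u \<or> \<sigma> u')"
        by (rule node_value.intros) (use P nv Or_Gate in auto)
      with Or_Gate val show ?thesis by simp
    next
      case (Not_Gate u)
      then have "node_value C x y v (\<not> \<sigma> u)"
        by (rule node_value.intros) (use P nv Not_Gate in auto)
      with Not_Gate val show ?thesis by simp
    qed auto
  qed
  moreover have "\<sigma> (out_node C)" using y by (simp add: accepts_def \<sigma>_def)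
  ultimately show "\<exists>\<sigma>. \<sigma> (out_node C) \<and> (\<forall>v\<in>gates C. satisfied C x \<sigma> v)"
    by blast
next
  have circ: "is_circuit n m C" using C by (simp add: nondeterministic_circuit_def)
  assume "\<exists>\<sigma>. \<sigma> (out_node C) \<and> (\<forall>v\<in>gates C. satisfied C x \<sigma> v)"
  then obtain \<sigma> where \<sigma>: "\<sigma> (out_node C)" "\<And>v. v \<in> gates C \<Longrightarrow> satisfied C x \<sigma> v" by blast
  define y where "y = map (\<lambda>j. \<exists>v\<in>nodes C. label C v = Guess j \<and> \<sigma> v) [0..<m]"
  have guess: "y ! j \<longleftrightarrow> \<sigma> v" if v: "v \<in> nodes C" "label C v = Guess j" for v j
  proof -
    have "j < m" using circ v by (auto simp: is_circuit_def)
    then have "y ! j \<longleftrightarrow> (\<exists>u\<in>nodes C. label C u = Guess j \<and> \<sigma> u)" by (simp add: y_def)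
    also have "\<dots> \<longleftrightarrow> \<sigma> v" using C v unfolding nondeterministic_circuit_def by blast
    finally show ?thesis .
  qed
  \<comment> \<open>An input read by no gate is unconstrained, so agreement is claimed only for
    gates and for inputs on which \<sigma> is already correct. Every argument of a satisfied gate is
    of one of these kinds.\<close>
  have "node_value C x y v (\<sigma> v)"
    if "v \<in> nodes C" "is_gate (label C v) \<or> input_ok x (label C v) (\<sigma> v)" for v
    using wf_adj[OF circ] that
  proof (induction v rule: wf_induct_rule)
    case (less v)
    show ?case
    proof (cases "is_gate (label C v)")
      case True
      with less.prems have sat: "satisfied C x \<sigma> v" by (intro \<sigma>(2)) (simp add: gates_def)
      have "node_value C x y u (\<sigma> u)" if u: "u \<in> set (preds (label C v))" for u
      proof (rule less.IH)
        show "(u, v) \<in> adj C" using u less.prems(1) by (rule preds_adj[rotated])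
        show "u \<in> nodes C" using circ u less.prems(1) unfolding is_circuit_def by blast
        show "is_gate (label C u) \<or> input_ok x (label C u) (\<sigma> u)"
          using sat u by (simp add: satisfied_def)
      qed
      then show ?thesis
        using sat True unfolding satisfied_def
        by (cases "label C v") (simp_all add: node_value_iff, blast+)
    next
      case False
      with less.prems guess show ?thesis
        by (cases "label C v") (auto simp: node_value_iff)
    qed
  qed
  then have "node_value C x y (out_node C) True"
    using out \<sigma>(1) unfolding gates_def by fastforce
  moreover have "length y = m" by (simp add: y_def)
  ultimately show "\<exists>y. length y = m \<and> accepts C x y" unfolding accepts_def by blast
qed

section \<open>Divide and conquer over the gates\<close>

text \<open>The recursive call is the left argument, hence evaluated first: a single accumulator
  holds the result so far, and the width exceeds that of the members by at most one, whatever the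
  length of the list.\<close>

fun fdisj :: "formula list \<Rightarrow> formula" where
  "fdisj [] = FConst False"
| "fdisj (F # Fs) = FOr (fdisj Fs) F"

fun fconj :: "formula list \<Rightarrow> formula" where
  "fconj [] = FConst True"
| "fconj (F # Fs) = FAnd (fconj Fs) F"

lemma holds_fdisj [simp]: "holds x (fdisj Fs) \<longleftrightarrow> (\<exists>F\<in>set Fs. holds x F)"
  by (induction Fs) auto

lemma holds_fconj [simp]: "holds x (fconj Fs) \<longleftrightarrow> (\<forall>F\<in>set Fs. holds x F)"
  by (induction Fs) auto

lemma fvars_fdisj [simp]: "fvars (fdisj Fs) = (\<Union>F\<in>set Fs. fvars F)"
  by (induction Fs) auto

lemma fvars_fconj [simp]: "fvars (fconj Fs) = (\<Union>F\<in>set Fs. fvars F)"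
  by (induction Fs) auto

lemma gate_count_fdisj:
  "(\<And>F. F \<in> set Fs \<Longrightarrow> gate_count F \<le> B) \<Longrightarrow> gate_count (fdisj Fs) \<le> length Fs * (B + 1)"
  by (induction Fs) (simp, fastforce)

lemma fwidth_fdisj:
  "(\<And>F. F \<in> set Fs \<Longrightarrow> fwidth F \<le> B) \<Longrightarrow> fwidth (fdisj Fs) \<le> B + 1"
  by (induction Fs) auto

section \<open>Enumeration of assignments and the test of a single gate\<close>

fun assignments :: "nat list \<Rightarrow> (nat \<Rightarrow> bool) \<Rightarrow> (nat \<Rightarrow> bool) list" where
  "assignments [] \<sigma> = [\<sigma>]"
| "assignments (v # vs) \<sigma> = assignments vs (\<sigma>(v := False)) @ assignments vs (\<sigma>(v := True))"

lemma length_assignments [simp]: "length (assignments vs \<sigma>) = 2 ^ length vs"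
  by (induction vs arbitrary: \<sigma>) auto

lemma set_assignments: "set (assignments vs \<sigma>) = {\<tau>. \<forall>v. v \<notin> set vs \<longrightarrow> \<tau> v = \<sigma> v}"
proof (induction vs arbitrary: \<sigma>)
  case (Cons a vs)
  show ?case unfolding assignments.simps set_append Cons.IH by auto
qed auto

fun literal :: "node_label \<Rightarrow> bool \<Rightarrow> formula" where
  "literal (Const c) b = FConst (b = c)"
| "literal (Actual i) b = (if b then FVar i else FNot (FVar i))"
| "literal _ b = FConst True"

text \<open>The assignment is fixed when the formula is built, so the gate condition is a mere
  constant; only actual inputs among the arguments leave variables in the formula.\<close>

definition check_gate :: "circuit \<Rightarrow> nat \<Rightarrow> (nat \<Rightarrow> bool) \<Rightarrow> formula" where
  "check_gate C v \<sigma> = fconj (FConst (gate_ok (label C v) \<sigma> (\<sigma> v)) #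
     map (\<lambda>u. literal (label C u) (\<sigma> u)) (preds (label C v)))"

lemma holds_check_gate: "holds x (check_gate C v \<sigma>) \<longleftrightarrow> satisfied C x \<sigma> v"
proof -
  have "holds x (literal l b) \<longleftrightarrow> input_ok x l b" for l b by (cases l) auto
  then show ?thesis by (auto simp: check_gate_def satisfied_def)
qed

text \<open>There are at most three conjuncts, two of them literals with at most one negation each,
  giving 3 + 2 gates. The width is that of a literal plus one accumulator.\<close>

lemma check_gate_bounds:
  "gate_count (check_gate C v \<sigma>) \<le> 5" "fwidth (check_gate C v \<sigma>) \<le> 2"
proof -
  have lit: "gate_count (literal l b) \<le> 1" "fwidth (literal l b) \<le> 1" for l b by (cases l; simp)+
  have "gate_count (check_gate C v \<sigma>) \<le> 5 \<and> fwidth (check_gate C v \<sigma>) \<le> 2"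
  proof (cases "label C v")
    case (And_Gate u u')
    then show ?thesis
      using lit[of "label C u" "\<sigma> u"] lit[of "label C u'" "\<sigma> u'"] by (simp add: check_gate_def)
  next
    case (Or_Gate u u')
    then show ?thesis
      using lit[of "label C u" "\<sigma> u"] lit[of "label C u'" "\<sigma> u'"] by (simp add: check_gate_def)
  next
    case (Not_Gate u)
    then show ?thesis using lit[of "label C u" "\<sigma> u"] by (simp add: check_gate_def)
  qed (simp_all add: check_gate_def)
  then show "gate_count (check_gate C v \<sigma>) \<le> 5" "fwidth (check_gate C v \<sigma>) \<le> 2" by auto
qed

text \<open>The cut is that of the whole sequence, not of the interval being solved: fixing further
  variables does no harm, and one bound then serves all intervals. \<open>remdups\<close> makes the
  length a cardinality.\<close>

definition straddling :: "circuit \<Rightarrow> nat list \<Rightarrow> nat \<Rightarrow> nat list" where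
  "straddling C gs t = filter (\<lambda>u. \<exists>g\<in>set (drop t gs). u \<in> set (vars C g))
     (remdups (concat (map (vars C) (take t gs))))"

lemma set_straddling:
  "set (straddling C gs t) = {u. \<exists>p q. p < t \<and> t \<le> q \<and> q < length gs \<and>
     u \<in> set (vars C (gs ! p)) \<and> u \<in> set (vars C (gs ! q))}" (is "_ = ?S")
proof -
  have "set (straddling C gs t) =
      {u. (\<exists>g\<in>set (take t gs). u \<in> set (vars C g)) \<and> (\<exists>g\<in>set (drop t gs). u \<in> set (vars C g))}"
    by (auto simp: straddling_def)
  also have "\<dots> = ?S"
  proof (intro set_eqI iffI)
    fix u assume "u \<in> {u. (\<exists>g\<in>set (take t gs). u \<in> set (vars C g)) \<and>
      (\<exists>g\<in>set (drop t gs). u \<in> set (vars C g))}"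
    then obtain g h where g: "g \<in> set (take t gs)" "u \<in> set (vars C g)"
      and h: "h \<in> set (drop t gs)" "u \<in> set (vars C h)"
      by blast
    obtain p where p: "p < t" "g = gs ! p"
      using g(1) by (auto simp: in_set_conv_nth)
    obtain q where q: "t + q < length gs" "h = gs ! (t + q)"
      using h(1) by (force simp: in_set_conv_nth)
    have "p < t \<and> t \<le> t + q \<and> t + q < length gs \<and>
        u \<in> set (vars C (gs ! p)) \<and> u \<in> set (vars C (gs ! (t + q)))"
      using g h p q by simp
    then show "u \<in> ?S" by blast
  next
    fix u assume "u \<in> ?S"
    then obtain p q where pq: "p < t" "t \<le> q" "q < length gs"
      "u \<in> set (vars C (gs ! p))" "u \<in> set (vars C (gs ! q))" by blast
    have "gs ! p \<in> set (take t gs)"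
      using pq by (auto simp: in_set_conv_nth intro!: exI[of _ p])
    moreover have "gs ! q \<in> set (drop t gs)"
      using pq by (auto simp: in_set_conv_nth intro!: exI[of _ "q - t"])
    ultimately show "u \<in> {u. (\<exists>g\<in>set (take t gs). u \<in> set (vars C g)) \<and>
      (\<exists>g\<in>set (drop t gs). u \<in> set (vars C g))}" using pq by blast
  qed
  finally show ?thesis .
qed

text \<open>\<open>solve C gs d i X \<sigma>\<close>: the \<open>2 ^ d\<close> gates from position \<open>i\<close> on can be satisfied by an
  assignment that agrees with \<open>\<sigma>\<close> on \<open>X\<close>.\<close>

fun solve :: "circuit \<Rightarrow> nat list \<Rightarrow> nat \<Rightarrow> nat \<Rightarrow> nat set \<Rightarrow> (nat \<Rightarrow> bool) \<Rightarrow> formula" where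
  "solve C gs 0 i X \<sigma> =
     (if i < length gs
      then fdisj (map (check_gate C (gs ! i)) (assignments (filter (\<lambda>u. u \<notin> X) (vars C (gs ! i))) \<sigma>))
      else FConst True)"
| "solve C gs (Suc d) i X \<sigma> =
     fdisj (map (\<lambda>\<tau>. FAnd (solve C gs d i (X \<union> set (straddling C gs (i + 2 ^ d))) \<tau>)
                           (solve C gs d (i + 2 ^ d) (X \<union> set (straddling C gs (i + 2 ^ d))) \<tau>))
       (assignments (filter (\<lambda>u. u \<notin> X) (straddling C gs (i + 2 ^ d))) \<sigma>))"

text \<open>Once the variables straddling the midpoint are fixed, the halves share no free variable,
  so separate solutions can be glued. Positions beyond the end of \<open>gs\<close> are vacuous, so
  the number of gates may fail to be a power of two.\<close>

lemma holds_solve: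
  "holds x (solve C gs d i X \<sigma>) \<longleftrightarrow> (\<exists>\<tau>. (\<forall>u\<in>X. \<tau> u = \<sigma> u) \<and>
     (\<forall>p. i \<le> p \<and> p < i + 2 ^ d \<and> p < length gs \<longrightarrow> satisfied C x \<tau> (gs ! p)))"
proof (induction d arbitrary: i X \<sigma>)
  case 0
  show ?case
  proof (cases "i < length gs")
    case True
    have p: "i \<le> p \<and> p < i + 2 ^ 0 \<and> p < length gs \<longleftrightarrow> p = i" for p using True by auto
    let ?V = "set (vars C (gs ! i))"
    have "holds x (solve C gs 0 i X \<sigma>) \<longleftrightarrow>
        (\<exists>\<tau>. (\<forall>v. \<not> (v \<in> ?V \<and> v \<notin> X) \<longrightarrow> \<tau> v = \<sigma> v) \<and> satisfied C x \<tau> (gs ! i))"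
      using True by (auto simp: set_assignments holds_check_gate)
    also have "\<dots> \<longleftrightarrow> (\<exists>\<tau>. (\<forall>u\<in>X. \<tau> u = \<sigma> u) \<and> satisfied C x \<tau> (gs ! i))"
    proof
      assume "\<exists>\<tau>. (\<forall>u\<in>X. \<tau> u = \<sigma> u) \<and> satisfied C x \<tau> (gs ! i)"
      then obtain \<tau> where \<tau>: "\<forall>u\<in>X. \<tau> u = \<sigma> u" "satisfied C x \<tau> (gs ! i)" by blast
      let ?\<tau> = "\<lambda>v. if v \<in> ?V then \<tau> v else \<sigma> v"
      have "satisfied C x ?\<tau> (gs ! i) \<longleftrightarrow> satisfied C x \<tau> (gs ! i)"
        by (rule satisfied_cong) simp
      with \<tau> show "\<exists>\<tau>. (\<forall>v. \<not> (v \<in> ?V \<and> v \<notin> X) \<longrightarrow> \<tau> v = \<sigma> v) \<and> satisfied C x \<tau> (gs ! i)"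
        by (intro exI[of _ ?\<tau>]) auto
    qed auto
    finally show ?thesis unfolding p by simp
  qed auto
next
  case (Suc d)
  let ?t = "i + 2 ^ d"
  let ?M = "set (straddling C gs ?t)"
  define sat where "sat j \<tau> \<longleftrightarrow>
    (\<forall>p. j \<le> p \<and> p < j + 2 ^ d \<and> p < length gs \<longrightarrow> satisfied C x \<tau> (gs ! p))" for j \<tau>
  have step: "holds x (solve C gs (Suc d) i X \<sigma>) \<longleftrightarrow>
      (\<exists>\<tau>. (\<forall>v. \<not> (v \<in> ?M \<and> v \<notin> X) \<longrightarrow> \<tau> v = \<sigma> v) \<and>
        (\<exists>\<tau>'. (\<forall>u\<in>X \<union> ?M. \<tau>' u = \<tau> u) \<and> sat i \<tau>') \<and>
        (\<exists>\<tau>'. (\<forall>u\<in>X \<union> ?M. \<tau>' u = \<tau> u) \<and> sat ?t \<tau>'))"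
    by (simp add: set_assignments Suc.IH sat_def del: Un_iff)
  have halves: "(\<forall>p. i \<le> p \<and> p < i + 2 ^ Suc d \<and> p < length gs \<longrightarrow> satisfied C x \<tau> (gs ! p)) \<longleftrightarrow>
      sat i \<tau> \<and> sat ?t \<tau>" for \<tau>
  proof -
    have "i \<le> p \<and> p < i + 2 ^ Suc d \<and> p < length gs \<longleftrightarrow>
        (i \<le> p \<and> p < i + 2 ^ d \<and> p < length gs) \<or> (?t \<le> p \<and> p < ?t + 2 ^ d \<and> p < length gs)" for p
      by auto
    then show ?thesis unfolding sat_def by blast
  qed
  show ?case unfolding step halves
  proof
    assume "\<exists>\<tau>. (\<forall>u\<in>X. \<tau> u = \<sigma> u) \<and> sat i \<tau> \<and> sat ?t \<tau>"
    then obtain \<tau> where \<tau>: "\<forall>u\<in>X. \<tau> u = \<sigma> u" "sat i \<tau>" "sat ?t \<tau>" by blast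
    \<comment> \<open>The disjunct to choose copies the solution on the cut and keeps \<sigma>
      elsewhere; the solution itself then witnesses both halves.\<close>
    let ?\<tau> = "\<lambda>v. if v \<in> ?M then \<tau> v else \<sigma> v"
    have "\<forall>u\<in>X \<union> ?M. \<tau> u = ?\<tau> u" "\<forall>v. \<not> (v \<in> ?M \<and> v \<notin> X) \<longrightarrow> ?\<tau> v = \<sigma> v"
      using \<tau>(1) by auto
    with \<tau> show "\<exists>\<tau>. (\<forall>v. \<not> (v \<in> ?M \<and> v \<notin> X) \<longrightarrow> \<tau> v = \<sigma> v) \<and>
        (\<exists>\<tau>'. (\<forall>u\<in>X \<union> ?M. \<tau>' u = \<tau> u) \<and> sat i \<tau>') \<and>
        (\<exists>\<tau>'. (\<forall>u\<in>X \<union> ?M. \<tau>' u = \<tau> u) \<and> sat ?t \<tau>')"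
      by (intro exI[of _ ?\<tau>] conjI exI[of _ \<tau>])
  next
    assume "\<exists>\<tau>. (\<forall>v. \<not> (v \<in> ?M \<and> v \<notin> X) \<longrightarrow> \<tau> v = \<sigma> v) \<and>
        (\<exists>\<tau>'. (\<forall>u\<in>X \<union> ?M. \<tau>' u = \<tau> u) \<and> sat i \<tau>') \<and>
        (\<exists>\<tau>'. (\<forall>u\<in>X \<union> ?M. \<tau>' u = \<tau> u) \<and> sat ?t \<tau>')"
    then obtain \<tau> \<tau>\<^sub>1 \<tau>\<^sub>2 where \<tau>: "\<forall>v. \<not> (v \<in> ?M \<and> v \<notin> X) \<longrightarrow> \<tau> v = \<sigma> v"
      and \<tau>\<^sub>1: "\<forall>u\<in>X \<union> ?M. \<tau>\<^sub>1 u = \<tau> u" "sat i \<tau>\<^sub>1"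
      and \<tau>\<^sub>2: "\<forall>u\<in>X \<union> ?M. \<tau>\<^sub>2 u = \<tau> u" "sat ?t \<tau>\<^sub>2"
      by (elim exE conjE) (rule that; assumption)
    \<comment> \<open>\<open>U\<close> holds the variables of the first half. The glued assignment
      follows the first solution on \<open>U\<close> and the second one outside; a variable of
      \<open>U\<close> that also occurs in the second half straddles the cut, where both solutions
      agree.\<close>
    define U where "U = {u. \<exists>p. i \<le> p \<and> p < ?t \<and> p < length gs \<and> u \<in> set (vars C (gs ! p))}"
    let ?\<tau> = "\<lambda>u. if u \<in> U then \<tau>\<^sub>1 u else \<tau>\<^sub>2 u"
    have "sat i ?\<tau>"
      unfolding sat_def
    proof (intro allI impI)
      fix p assume p: "i \<le> p \<and> p < ?t \<and> p < length gs"
      have "satisfied C x ?\<tau> (gs ! p) \<longleftrightarrow> satisfied C x \<tau>\<^sub>1 (gs ! p)"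
        by (rule satisfied_cong) (use p in \<open>auto simp: U_def\<close>)
      then show "satisfied C x ?\<tau> (gs ! p)" using \<tau>\<^sub>1(2) p by (simp add: sat_def)
    qed
    moreover have "sat ?t ?\<tau>"
      unfolding sat_def
    proof (intro allI impI)
      fix q assume q: "?t \<le> q \<and> q < ?t + 2 ^ d \<and> q < length gs"
      have "?\<tau> u = \<tau>\<^sub>2 u" if "u \<in> set (vars C (gs ! q))" for u
      proof (cases "u \<in> U")
        case True
        then have "u \<in> ?M" using q that unfolding set_straddling U_def by blast
        then show ?thesis using \<tau>\<^sub>1(1) \<tau>\<^sub>2(1) by simp
      qed simp
      then have "satisfied C x ?\<tau> (gs ! q) \<longleftrightarrow> satisfied C x \<tau>\<^sub>2 (gs ! q)"
        by (rule satisfied_cong)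
      then show "satisfied C x ?\<tau> (gs ! q)" using \<tau>\<^sub>2(2) q by (simp add: sat_def)
    qed
    moreover have "\<forall>u\<in>X. ?\<tau> u = \<sigma> u" using \<tau> \<tau>\<^sub>1(1) \<tau>\<^sub>2(1) by auto
    ultimately show "\<exists>\<tau>. (\<forall>u\<in>X. \<tau> u = \<sigma> u) \<and> sat i \<tau> \<and> sat ?t \<tau>"
      by (intro exI[of _ ?\<tau>] conjI)
  qed
qed

text \<open>Each level adds two accumulators, one for the disjunction and one for the left half of
  the conjunction. The base value 3 is the width 2 of a gate test plus one.\<close>

lemma fwidth_solve: "fwidth (solve C gs d i X \<sigma>) \<le> 3 + 2 * d"
proof (induction d arbitrary: i X \<sigma>)
  case 0
  have "fwidth (fdisj (map (check_gate C (gs ! i)) \<tau>s)) \<le> 2 + 1" for \<tau>s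
    by (rule fwidth_fdisj) (use check_gate_bounds in auto)
  then show ?case by simp
next
  case (Suc d)
  have "fwidth (FAnd (solve C gs d i Y \<tau>) (solve C gs d j Y \<tau>)) \<le> 3 + 2 * d + 1" for j Y \<tau>
    using Suc.IH[of i Y \<tau>] Suc.IH[of j Y \<tau>] by simp
  then have "fwidth (solve C gs (Suc d) i X \<sigma>) \<le> (3 + 2 * d + 1) + 1"
    unfolding solve.simps by (intro fwidth_fdisj) auto
  then show ?case by simp
qed

text \<open>A level has at most \<open>2 ^ K\<close> disjuncts, each with two recursive calls of
  size \<open>T\<close> and two connectives; \<open>2 * T + 2 \<le> 4 * T\<close> yields the factor
  \<open>2 ^ (K + 2)\<close>. At the bottom, at most \<open>2 ^ 3\<close> tests cost 6 gates each,
  which is below \<open>2 ^ 6\<close>.\<close>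

lemma gate_count_solve:
  assumes K: "\<And>t. length (straddling C gs t) \<le> K"
  shows "gate_count (solve C gs d i X \<sigma>) \<le> 2 ^ (6 + d * (K + 2))"
proof (induction d arbitrary: i X \<sigma>)
  case 0
  let ?vs = "filter (\<lambda>u. u \<notin> X) (vars C (gs ! i))"
  have "length (vars C (gs ! i)) \<le> 3"
    by (cases "label C (gs ! i)") (auto simp: vars_def)
  then have "length ?vs \<le> 3" using length_filter_le le_trans by blast
  then have vs: "(2::nat) ^ length ?vs \<le> 2 ^ 3" by (intro power_increasing) auto
  have "gate_count (fdisj (map (check_gate C (gs ! i)) (assignments ?vs \<sigma>))) \<le>
      length (map (check_gate C (gs ! i)) (assignments ?vs \<sigma>)) * (5 + 1)"
    by (rule gate_count_fdisj) (use check_gate_bounds in auto)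
  with vs show ?case by simp
next
  case (Suc d)
  let ?vs = "filter (\<lambda>u. u \<notin> X) (straddling C gs (i + 2 ^ d))"
  let ?T = "2 ^ (6 + d * (K + 2)) :: nat"
  have "length ?vs \<le> K" using K length_filter_le le_trans by blast
  then have vs: "(2::nat) ^ length ?vs \<le> 2 ^ K" by (intro power_increasing) auto
  have "gate_count (solve C gs (Suc d) i X \<sigma>) \<le> 2 ^ length ?vs * ((?T + ?T + 1) + 1)"
    unfolding solve.simps
    by (rule order.trans[OF gate_count_fdisj[where B = "?T + ?T + 1"]])
      (use Suc.IH in \<open>auto intro!: add_mono\<close>)
  also have "\<dots> \<le> 2 ^ K * (4 * ?T)"
  proof (rule mult_mono[OF vs])
    have "1 \<le> ?T" by simp
    then show "(?T + ?T + 1) + 1 \<le> 4 * ?T" by linarith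
  qed auto
  also have "\<dots> = 2 ^ (6 + Suc d * (K + 2))" by (simp add: power_add)
  finally show ?case .
qed

lemma fvars_solve:
  assumes "\<And>g u j. g \<in> set gs \<Longrightarrow> u \<in> set (preds (label C g)) \<Longrightarrow> label C u = Actual j \<Longrightarrow> j < n"
  shows "fvars (solve C gs d i X \<sigma>) \<subseteq> {..<n}"
proof (induction d arbitrary: i X \<sigma>)
  case 0
  have lit: "fvars (literal l b) \<subseteq> {j. l = Actual j}" for l b by (cases l) auto
  have "fvars (check_gate C (gs ! i) \<tau>) \<subseteq> {..<n}" if "i < length gs" for \<tau>
    using assms[of "gs ! i"] that lit by (fastforce simp: check_gate_def)
  then show ?case by auto
next
  case (Suc d)
  then show ?case by (simp add: UN_subset_iff)
qed

text \<open>A variable straddling the cut before a gate on layer \<open>k\<close> is a gate on layer \<open>k\<close>, an argument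
  of such a gate, or the source of an edge that jumps over layer \<open>k\<close>.\<close>

lemma length_straddling:
  assumes circ: "is_circuit n m C" and l: "layering C l" and w: "\<And>k. layer_width C l k \<le> w"
    and gs: "set gs = gates C" "distinct gs" "sorted (map l gs)"
  shows "length (straddling C gs t) \<le> 3 * w"
proof (cases "t < length gs")
  case True
  \<comment> \<open>The layer of the first gate after the cut: gates before the cut lie on layers up
    to \<open>k\<close>, those after it on layers from \<open>k\<close> on.\<close>
  define k where "k = l (gs ! t)"
  define G where "G = {v \<in> gates C. l v = k}"
  define P where "P v = set (preds (label C v))" for v
  have fin: "finite (gates C)" "finite (edges C)"
    using circ finite_edges by (auto simp: is_circuit_def gates_def)
  have finG: "finite G" "finite (copy_gates C l k)"
    using fin by (auto simp: G_def copy_gates_def intro: finite_subset)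
  have edge: "l u < l v" "\<exists>i. (u, v, i) \<in> edges C" if "v \<in> gates C" "u \<in> P v" for u v
    using preds_adj[of v C u] that l unfolding layering_def adj_def gates_def P_def by auto
  have sub: "set (straddling C gs t) \<subseteq> G \<union> fst ` copy_gates C l k \<union> (\<Union>v\<in>G. P v)"
  proof
    fix u assume "u \<in> set (straddling C gs t)"
    then obtain p q where pq: "p < t" "t \<le> q" "q < length gs"
      "u \<in> set (vars C (gs ! p))" "u \<in> set (vars C (gs ! q))"
      unfolding set_straddling by blast
    have ord: "l (gs ! p) \<le> k" "k \<le> l (gs ! q)"
      unfolding k_def using sorted_nth_mono[OF gs(3)] pq True by fastforce+
    have g: "gs ! p \<in> gates C" "gs ! q \<in> gates C" "gs ! p \<noteq> gs ! q"
      using pq gs nth_eq_iff_index_eq by fastforce+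
    have "u = gs ! p \<or> u \<in> P (gs ! p)" "u = gs ! q \<or> u \<in> P (gs ! q)"
      using pq by (auto simp: vars_def P_def)
    \<comment> \<open>If \<open>u\<close> were the later gate itself, it would be an argument of the
      earlier one and so lie strictly below layer \<open>k\<close>, which is impossible.\<close>
    then have u: "u \<in> P (gs ! q)" "u = gs ! p \<or> l u < k"
      using edge[OF g(1), of u] g(3) ord by auto
    obtain i where i: "(u, gs ! q, i) \<in> edges C" using edge[OF g(2) u(1)] by blast
    consider "u = gs ! p" "l u = k" | "l u < k" "l (gs ! q) = k" | "l u < k" "k < l (gs ! q)"
      using u(2) ord by fastforce
    then show "u \<in> G \<union> fst ` copy_gates C l k \<union> (\<Union>v\<in>G. P v)"
    proof cases
      case 1
      then show ?thesis using g by (simp add: G_def)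
    next
      case 2
      then show ?thesis using g u by (auto simp: G_def)
    next
      case 3
      then have "(u, gs ! q, i) \<in> copy_gates C l k" using i by (simp add: copy_gates_def)
      then show ?thesis by force
    qed
  qed
  have P: "finite (P v)" "card (P v) \<le> 2" for v
    using card_length[of "preds (label C v)"] by (cases "label C v"; force simp: P_def)+
  have "distinct (straddling C gs t)"
    by (simp add: straddling_def)
  then have "length (straddling C gs t) = card (set (straddling C gs t))"
    by (rule distinct_card[symmetric])
  also have "\<dots> \<le> card (G \<union> fst ` copy_gates C l k \<union> (\<Union>v\<in>G. P v))"
    by (rule card_mono) (use finG P sub in auto)
  also have "\<dots> \<le> card G + card (fst ` copy_gates C l k) + card (\<Union>v\<in>G. P v)"
    by (intro order.trans[OF card_Un_le] add_mono card_Un_le) auto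
  also have "card (fst ` copy_gates C l k) \<le> card (copy_gates C l k)"
    using finG(2) by (rule card_image_le)
  also have "card (\<Union>v\<in>G. P v) \<le> (\<Sum>v\<in>G. card (P v))"
    using finG(1) by (rule card_UN_le)
  \<comment> \<open>Fan-in is two. The three summands together are at most
    \<open>3 * card G + card (copy_gates C l k)\<close>, hence at most three times the width of
    layer \<open>k\<close>.\<close>
  also have "\<dots> \<le> card G * 2"
    using sum_bounded_above[of G "\<lambda>v. card (P v)" 2] P by simp
  finally show ?thesis
    using w[of k] unfolding layer_width_def G_def by linarith
next
  case False
  then show ?thesis by (simp add: straddling_def)
qed

section \<open>Circuits with at most one gate\<close>

text \<open>The parameter \<open>b\<close> is the value chosen for guess inputs.\<close>

fun leaf :: "bool \<Rightarrow> node_label \<Rightarrow> formula" where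
  "leaf b (Const c) = FConst c"
| "leaf b (Actual i) = FVar i"
| "leaf b _ = FConst b"

lemma leaf_simps [simp]:
  "gate_count (leaf b l) = 0" "fwidth (leaf b l) = 0" "fvars (leaf b l) = {i. l = Actual i}"
  by (cases l; auto)+

lemma input_ok_leaf: "input_ok x l (holds x (leaf b l))"
  by (cases l) auto

text \<open>Among the values an input may carry, \<open>leaf True\<close> is the largest and, by the
  next lemma, \<open>leaf False\<close> the smallest. The former decides monotone gates, the latter
  negations.\<close>

lemma leaf_greatest: "input_ok x l b \<Longrightarrow> \<not> is_gate l \<Longrightarrow> b \<Longrightarrow> holds x (leaf True l)"
  by (cases l) auto

lemma leaf_least: "input_ok x l b \<Longrightarrow> \<not> is_gate l \<Longrightarrow> holds x (leaf False l) \<Longrightarrow> b"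
  by (cases l) auto

text \<open>The output depends on one input node only, and if that is a guess, setting all guesses
  to True makes the circuit accept. There may still be gates elsewhere.\<close>

lemma input_output_formula:
  assumes C: "nondeterministic_circuit n m C" and out: "out_node C \<notin> gates C"
  obtains F where "fvars F \<subseteq> {..<n}" "gate_count F = 0" "fwidth F = 0"
    "\<And>x. (\<exists>y. length y = m \<and> accepts C x y) \<longleftrightarrow> holds x F"
proof (rule that[of "leaf True (label C (out_node C))"])
  let ?l = "label C (out_node C)"
  have "out_node C \<in> nodes C" using C by (simp add: nondeterministic_circuit_def is_circuit_def)
  then have l: "\<not> is_gate ?l" "\<And>i. ?l = Actual i \<Longrightarrow> i < n" "\<And>j. ?l = Guess j \<Longrightarrow> j < m"
    using C out by (auto simp: nondeterministic_circuit_def is_circuit_def gates_def)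
  show "fvars (leaf True ?l) \<subseteq> {..<n}" using l(2) by auto
  show "(\<exists>y. length y = m \<and> accepts C x y) \<longleftrightarrow> holds x (leaf True ?l)" for x
  proof (cases ?l)
    case (Guess j)
    then have "length (replicate m True) = m \<and> accepts C x (replicate m True)"
      using l(3) by (simp add: accepts_def node_value_iff)
    with Guess show ?thesis by fastforce
  qed (use l(1) in \<open>auto simp: accepts_def node_value_iff intro: exI[of _ "replicate m True"]\<close>)
qed auto

text \<open>For size one the logarithm vanishes, so the final bounds allow one gate and no
  additional width. The arguments of the only gate are inputs, and the best guess is True below AND
  and OR, False below NOT.\<close>

lemma single_gate_formula:
  assumes C: "nondeterministic_circuit n m C" and out: "gates C = {out_node C}"
  obtains F where "fvars F \<subseteq> {..<n}" "gate_count F \<le> 1" "fwidth F \<le> 1"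
    "\<And>x. (\<exists>y. length y = m \<and> accepts C x y) \<longleftrightarrow> holds x F"
proof -
  let ?g = "out_node C"
  have circ: "is_circuit n m C" using C by (simp add: nondeterministic_circuit_def)
  obtain l where "layering C l" using ex_layering[OF circ] by blast
  have input: "u \<noteq> ?g" "\<not> is_gate (label C u)" "\<And>i. label C u = Actual i \<Longrightarrow> i < n"
    if "u \<in> set (preds (label C ?g))" for u
  proof -
    have g: "?g \<in> nodes C" using circ by (simp add: is_circuit_def)
    with that \<open>layering C l\<close> show "u \<noteq> ?g"
      using preds_adj[of ?g C u] by (auto simp: layering_def)
    have u: "u \<in> nodes C" using that circ g unfolding is_circuit_def by blast
    with \<open>u \<noteq> ?g\<close> show "\<not> is_gate (label C u)" using out by (auto simp: gates_def)
    show "i < n" if "label C u = Actual i" for i using u that circ by (auto simp: is_circuit_def)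
  qed
  have acc: "(\<exists>y. length y = m \<and> accepts C x y) \<longleftrightarrow> (\<exists>\<sigma>. \<sigma> ?g \<and> satisfied C x \<sigma> ?g)" for x
    using accepts_iff_satisfiable[OF C] out by simp
  have sat: "\<exists>\<sigma>. \<sigma> ?g \<and> satisfied C x \<sigma> ?g"
    if "gate_ok (label C ?g) (\<lambda>u. holds x (leaf b (label C u))) True" for x b
  proof -
    \<comment> \<open>The output is set to True; no argument coincides with it, so the gate still
      reads the leaf values.\<close>
    let ?\<sigma> = "\<lambda>u. if u = ?g then True else holds x (leaf b (label C u))"
    have "gate_ok (label C ?g) ?\<sigma> (?\<sigma> ?g)"
      using that input(1) by (cases "label C ?g") auto
    then have "satisfied C x ?\<sigma> ?g"
      using input(1) input_ok_leaf by (auto simp: satisfied_def)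
    then show ?thesis by (intro exI[of _ ?\<sigma>]) simp
  qed
  have "is_gate (label C ?g)" using out by (auto simp: gates_def)
  then show thesis
  proof (cases "label C ?g")
    case (And_Gate u u')
    let ?F = "FAnd (leaf True (label C u)) (leaf True (label C u'))"
    have "(\<exists>\<sigma>. \<sigma> ?g \<and> satisfied C x \<sigma> ?g) \<longleftrightarrow> holds x ?F" for x
      using sat[of x True] input(2)[of u] input(2)[of u'] And_Gate
      by (auto simp: satisfied_def intro: leaf_greatest)
    moreover have "fvars ?F \<subseteq> {..<n}" using input(3) And_Gate by auto
    ultimately show thesis using acc by (intro that[of ?F]) simp_all
  next
    case (Or_Gate u u')
    let ?F = "FOr (leaf True (label C u)) (leaf True (label C u'))"
    have "(\<exists>\<sigma>. \<sigma> ?g \<and> satisfied C x \<sigma> ?g) \<longleftrightarrow> holds x ?F" for x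
      using sat[of x True] input(2)[of u] input(2)[of u'] Or_Gate
      by (auto simp: satisfied_def intro: leaf_greatest)
    moreover have "fvars ?F \<subseteq> {..<n}" using input(3) Or_Gate by auto
    ultimately show thesis using acc by (intro that[of ?F]) simp_all
  next
    case (Not_Gate u)
    let ?F = "FNot (leaf False (label C u))"
    have "(\<exists>\<sigma>. \<sigma> ?g \<and> satisfied C x \<sigma> ?g) \<longleftrightarrow> holds x ?F" for x
      using sat[of x False] input(2)[of u] Not_Gate
      by (auto simp: satisfied_def dest: leaf_least)
    moreover have "fvars ?F \<subseteq> {..<n}" using input(3) Not_Gate by auto
    ultimately show thesis using acc by (intro that[of ?F]) simp_all
  qed auto
qed

section \<open>The simulation\<close>

text \<open>The layer of any gate is nonempty. This lets additive constants be absorbed into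
  multiples of the width.\<close>

lemma circuit_width_pos:
  assumes circ: "is_circuit n m C" and "gates C \<noteq> {}"
  shows "0 < circuit_width C"
proof -
  obtain l where l: "\<And>k. layer_width C l k \<le> circuit_width C"
    using circuit_width_attained[OF circ] by blast
  obtain g where g: "g \<in> gates C" using assms(2) by blast
  have "finite {v \<in> gates C. l v = l g}"
    using circ by (auto simp: is_circuit_def gates_def)
  then have "0 < card {v \<in> gates C. l v = l g}"
    using g by (auto simp: card_gt_0_iff)
  then show ?thesis using l[of "l g"] by (simp add: layer_width_def)
qed

lemma divide_and_conquer_formula:
  assumes C: "nondeterministic_circuit n m C" and out: "out_node C \<in> gates C"
    and d: "circuit_size C \<le> 2 ^ d"
  obtains F where "fvars F \<subseteq> {..<n}" "gate_count F \<le> 2 ^ (6 + d * (3 * circuit_width C + 2))"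
    "fwidth F \<le> 3 + 2 * d" "\<And>x. (\<exists>y. length y = m \<and> accepts C x y) \<longleftrightarrow> holds x F"
proof -
  have circ: "is_circuit n m C" using C by (simp add: nondeterministic_circuit_def)
  obtain l where l: "layering C l" "\<And>k. layer_width C l k \<le> circuit_width C"
    using circuit_width_attained[OF circ] by blast
  have fin: "finite (gates C)" using circ by (simp add: is_circuit_def gates_def)
  define gs where "gs = sort_key l (sorted_list_of_set (gates C))"
  have gs: "set gs = gates C" "distinct gs" "sorted (map l gs)"
    using fin by (simp_all add: gs_def)
  have len: "length gs \<le> 2 ^ d"
    using d gs by (metis circuit_size_def distinct_card)
  \<comment> \<open>Fixing the output node to True from the start expresses acceptance.\<close>
  let ?F = "solve C gs d 0 {out_node C} (\<lambda>_. True)"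
  show thesis
  proof (rule that)
    show "fvars ?F \<subseteq> {..<n}"
      by (rule fvars_solve) (use gs(1) circ in \<open>unfold gates_def is_circuit_def, blast\<close>)
    show "gate_count ?F \<le> 2 ^ (6 + d * (3 * circuit_width C + 2))"
      by (rule gate_count_solve) (rule length_straddling[OF circ l gs])
    show "fwidth ?F \<le> 3 + 2 * d" by (rule fwidth_solve)
    have "(\<forall>p. 0 \<le> p \<and> p < 0 + 2 ^ d \<and> p < length gs \<longrightarrow> satisfied C x \<tau> (gs ! p)) \<longleftrightarrow>
        (\<forall>v\<in>gates C. satisfied C x \<tau> v)" for x \<tau>
      using len unfolding gs(1)[symmetric] by (auto simp: all_set_conv_all_nth)
    then show "(\<exists>y. length y = m \<and> accepts C x y) \<longleftrightarrow> holds x ?F" for x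
      unfolding accepts_iff_satisfiable[OF C out] holds_solve by auto
  qed
qed

text \<open>Additive constants can be absorbed into multiples of \<open>L\<close> only if
  \<open>1 \<le> L\<close>, that is, from two gates on; hence the single gate is treated apart. An
  output that is an input carries no gate constraint and forms a third case.\<close>

lemma nondeterministic_circuit_formula:
  fixes L :: real
  assumes C: "nondeterministic_circuit n m C"
  defines "L \<equiv> log 2 (real (circuit_size C))"
  obtains F where "fvars F \<subseteq> {..<n}"
    "\<And>x. (\<exists>y. length y = m \<and> accepts C x y) \<longleftrightarrow> holds x F"
    "real (gate_count F) \<le> 2 powr (16 * ((real (circuit_width C) + L) * L))"
    "real (fwidth F) \<le> real (circuit_width C) + 7 * L"
proof (cases "out_node C \<in> gates C")
  case False
  \<comment> \<open>\<open>log 2 0 = 0\<close>, so this also holds for circuits without gates.\<close>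
  have "0 \<le> L" unfolding L_def by (cases "circuit_size C = 0") (auto simp: log_def)
  obtain F where "fvars F \<subseteq> {..<n}" "gate_count F = 0" "fwidth F = 0"
    "\<And>x. (\<exists>y. length y = m \<and> accepts C x y) \<longleftrightarrow> holds x F"
    using input_output_formula[OF C False] by blast
  with \<open>0 \<le> L\<close> that show thesis by simp
next
  case out: True
  have circ: "is_circuit n m C" using C by (simp add: nondeterministic_circuit_def)
  have fin: "finite (gates C)" using circ by (simp add: is_circuit_def gates_def)
  let ?s = "circuit_size C" and ?w = "circuit_width C"
  have "?s \<noteq> 0" using out fin by (auto simp: circuit_size_def)
  have w: "1 \<le> real ?w" using circuit_width_pos[OF circ] out by fastforce
  show thesis
  proof (cases "?s = 1")
    case True
    then have "gates C = {out_node C}"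
      using out by (metis card_1_singletonE circuit_size_def singletonD)
    then obtain F where F: "fvars F \<subseteq> {..<n}" "gate_count F \<le> 1" "fwidth F \<le> 1"
      "\<And>x. (\<exists>y. length y = m \<and> accepts C x y) \<longleftrightarrow> holds x F"
      using single_gate_formula[OF C] by blast
    have "L = 0" using True by (simp add: L_def)
    with F w show thesis by (intro that[of F]) auto
  next
    case False
    with \<open>?s \<noteq> 0\<close> have "2 \<le> ?s" by simp
    then have L: "1 \<le> L" unfolding L_def by (simp add: le_log_iff)
    define d where "d = nat \<lceil>L\<rceil>"
    have d: "L \<le> real d" "real d \<le> L + 1" using L unfolding d_def by linarith+
    have "real ?s = 2 powr L" using \<open>?s \<noteq> 0\<close> by (simp add: L_def)
    also have "\<dots> \<le> 2 powr real d" using d by simp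
    also have "\<dots> = real (2 ^ d)" by (simp add: powr_realpow)
    finally have "?s \<le> 2 ^ d" by linarith
    then obtain F where F: "fvars F \<subseteq> {..<n}" "gate_count F \<le> 2 ^ (6 + d * (3 * ?w + 2))"
      "fwidth F \<le> 3 + 2 * d" "\<And>x. (\<exists>y. length y = m \<and> accepts C x y) \<longleftrightarrow> holds x F"
      using divide_and_conquer_formula[OF C out] by blast
    have "real (6 + d * (3 * ?w + 2)) = 6 + real d * (3 * real ?w + 2)"
      by (simp add: algebra_simps)
    \<comment> \<open>From \<open>1 \<le> L\<close> and \<open>1 \<le> w\<close> follow
      \<open>d \<le> 2 * L\<close> and \<open>3 * w + 2 \<le> 5 * w\<close>. The sum is
      \<open>16 * w * L\<close>, the origin of the constant 16.\<close>
    also have "\<dots> \<le> 6 * (real ?w * L) + (2 * L) * (5 * real ?w)"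
    proof (intro add_mono mult_mono)
      show "6 \<le> 6 * (real ?w * L)" using mult_mono[OF w L] by simp
    qed (use d L w in auto)
    also have "\<dots> \<le> 16 * ((real ?w + L) * L)" using L by (simp add: algebra_simps)
    finally have e: "real (6 + d * (3 * ?w + 2)) \<le> 16 * ((real ?w + L) * L)" .
    have "real (gate_count F) \<le> 2 ^ (6 + d * (3 * ?w + 2))"
      using F(2) by (metis of_nat_le_iff of_nat_numeral of_nat_power)
    also have "\<dots> = 2 powr real (6 + d * (3 * ?w + 2))" by (simp only: powr_realpow)
    also have "\<dots> \<le> 2 powr (16 * ((real ?w + L) * L))" using e by (intro powr_mono) auto
    finally have "real (gate_count F) \<le> 2 powr (16 * ((real ?w + L) * L))" .
    \<comment> \<open>Here \<open>3 + 2 * d \<le> 5 + 2 * L \<le> 7 * L\<close>, the origin of the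
      constant 7.\<close>
    moreover have "real (fwidth F) \<le> real ?w + 7 * L"
      using F(3) d(2) L w by linarith
    ultimately show thesis using that F by blast
  qed
qed

theorem theorem3:
  shows "\<exists>a b :: real. \<forall>(n::nat) (m::nat) (s::nat) (w::nat) (C::circuit) (f :: bool list \<Rightarrow> bool).
    nondeterministic_circuit n m C \<and> circuit_size C = s \<and> circuit_width C = w \<and>
    nondet_computes n m C f \<longrightarrow>
    (\<exists>D::circuit. deterministic_circuit n D \<and> det_computes n D f \<and>
      real (circuit_size D) \<le> 2 powr (a * ((real w + log 2 (real s)) * log 2 (real s))) \<and>
      real (circuit_width D) \<le> real w + b * log 2 (real s))"
proof (rule exI[of _ 16], rule exI[of _ 7], intro allI impI, elim conjE)
  fix n m s w C f
  assume C: "nondeterministic_circuit n m C" and sw: "circuit_size C = s" "circuit_width C = w"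
    and f: "nondet_computes n m C f"
  obtain F where F: "fvars F \<subseteq> {..<n}"
    "\<And>x. (\<exists>y. length y = m \<and> accepts C x y) \<longleftrightarrow> holds x F"
    "real (gate_count F) \<le> 2 powr (16 * ((real w + log 2 (real s)) * log 2 (real s)))"
    "real (fwidth F) \<le> real w + 7 * log 2 (real s)"
    using nondeterministic_circuit_formula[OF C] unfolding sw by blast
  obtain D where D: "deterministic_circuit n D" "\<And>x. accepts D x [] \<longleftrightarrow> holds x F"
    "circuit_size D \<le> gate_count F" "circuit_width D \<le> fwidth F"
    using formula_circuit[OF F(1)] by blast
  show "\<exists>D. deterministic_circuit n D \<and> det_computes n D f \<and>
      real (circuit_size D) \<le> 2 powr (16 * ((real w + log 2 (real s)) * log 2 (real s))) \<and>
      real (circuit_width D) \<le> real w + 7 * log 2 (real s)"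
  proof (intro exI conjI)
    show "det_computes n D f"
      using f F(2) D(2) by (simp add: nondet_computes_def det_computes_def)
    show "real (circuit_size D) \<le> 2 powr (16 * ((real w + log 2 (real s)) * log 2 (real s)))"
      using D(3) F(3) by linarith
    show "real (circuit_width D) \<le> real w + 7 * log 2 (real s)"
      using D(4) F(4) by linarith
  qed (rule D(1))
qed

end
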